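(* Let $p\ge3$ be an integer, $\mu\in[0,1)$, and $\xi(t)=\mu t^2+(1-\mu)t^p$. Then the minimizer of $P_{0,\xi}$ on $\mathcal{C}$ is of the form $c+m(1-t)$ with $m,c\in(0,\infty)$ if and only if both (i) the replicon eigenvalue of $\xi$ is non-negative and (ii) $\xi$ is pure-like or critical.
   Context: $\mathcal{C}$ is the set of $\phi\in C([0,1])$ with $\phi\ge0$, non-increasing and concave; $P_{0,\xi}(\phi)=\int_0^1(\xi''\phi+1/\phi)dx$. For $\xi$ as in the claim (which is not of the form $at^2$), the system $$\xi(1)=\frac1m\Big(\frac1m\log\Big(\frac{c+m}{c}\Big)-\frac1{c+m}\Big),\qquad\frac1{\xi'(1)}=c(c+m)$$ has a unique solution with $m,c>0$. For this solution let $\phi(t)=m(1-t)+c$ and let $\eta(t)=\xi(1)-\int_t^1\int_0^s\phi(\tau)^{-2}d\tau\,ds$ (the formal conjugate). The replicon eigenvalue is $\eta''(0)-\xi''(0)$. With $\nu'=\xi'(1)$, $\nu''=\xi''(1)$ (and normalization $\xi(1)=1$), set $ABA=\log(\nu''/\nu')-\frac{(\nu''-\nu')(\nu''-\nu'+\nu'^2)}{\nu''\nu'^2}$; $\xi$ is pure-like if $ABA>0$, critical if $ABA=0$. *)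

theory Defs
  imports "HOL-Analysis.Analysis"
begin

definition xi_mix :: "real \<Rightarrow> nat \<Rightarrow> real \<Rightarrow> real" where
  "xi_mix mu p = (\<lambda>t. mu * t^2 + (1 - mu) * t^p)"

definition classC :: "(real \<Rightarrow> real) set" where
  "classC = {phi. continuous_on {0..1} phi \<and> (\<forall>x\<in>{0..1}. phi x \<ge> 0)
      \<and> (\<forall>x\<in>{0..1}. \<forall>y\<in>{0..1}. x \<le> y \<longrightarrow> phi y \<le> phi x)
      \<and> concave_on {0..1} phi}"

definition P0 :: "(real \<Rightarrow> real) \<Rightarrow> (real \<Rightarrow> real) \<Rightarrow> ereal" where
  "P0 xi phi =
     (if (\<forall>x\<in>{0..<1}. phi x > 0) \<and> (\<lambda>x. 1 / phi x) integrable_on {0..1}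
      then ereal (integral {0..1} (\<lambda>x. deriv (deriv xi) x * phi x + 1 / phi x))
      else \<infinity>)"

definition is_minimizer :: "(real \<Rightarrow> real) \<Rightarrow> (real \<Rightarrow> real) \<Rightarrow> bool" where
  "is_minimizer xi phi \<longleftrightarrow> phi \<in> classC \<and> (\<forall>psi\<in>classC. P0 xi phi \<le> P0 xi psi)"

definition mc_sol :: "(real \<Rightarrow> real) \<Rightarrow> real \<times> real" where
  "mc_sol xi = (THE (m, c). m > 0 \<and> c > 0 \<and>
       xi 1 = (1 / m) * ((1 / m) * ln ((c + m) / c) - 1 / (c + m)) \<and>
       1 / deriv xi 1 = c * (c + m))"

definition phi_sol :: "(real \<Rightarrow> real) \<Rightarrow> real \<Rightarrow> real" where
  "phi_sol xi = (\<lambda>t. fst (mc_sol xi) * (1 - t) + snd (mc_sol xi))"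

definition eta_conj :: "(real \<Rightarrow> real) \<Rightarrow> real \<Rightarrow> real" where
  "eta_conj xi = (\<lambda>t. xi 1 - integral {t..1} (\<lambda>s. integral {0..s} (\<lambda>tau. 1 / (phi_sol xi tau)^2)))"

definition replicon :: "(real \<Rightarrow> real) \<Rightarrow> real" where
  "replicon xi =
     vector_derivative (\<lambda>t. vector_derivative (eta_conj xi) (at t within {0..1})) (at 0 within {0..1})
     - deriv (deriv xi) 0"

definition ABA :: "(real \<Rightarrow> real) \<Rightarrow> real" where
  "ABA xi = (let n1 = deriv xi 1; n2 = deriv (deriv xi) 1 in
     ln (n2 / n1) - (n2 - n1) * (n2 - n1 + n1^2) / (n2 * n1^2))"

definition pure_like :: "(real \<Rightarrow> real) \<Rightarrow> bool" where
  "pure_like xi \<longleftrightarrow> ABA xi > 0"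

definition critical :: "(real \<Rightarrow> real) \<Rightarrow> bool" where
  "critical xi \<longleftrightarrow> ABA xi = 0"

end

theory Submission
  imports Defs
begin

text \<open>
  Write \<open>\<phi>(t) = c + m(1 - t)\<close> and call \<open>h = \<xi>'' - 1/\<phi>\<^sup>2\<close> the gap. By convexity of \<open>1/x\<close>, \<open>\<phi>\<close> is a
  minimizer iff \<open>\<integral> h (\<psi> - \<phi>) \<ge> 0\<close> for all admissible \<open>\<psi>\<close>. Perturbing \<open>\<phi>\<close> by \<open>\<plusminus>1\<close> and \<open>\<plusminus>(1 - t)\<close>
  gives \<open>\<integral> h = \<integral> h (1 - t) = 0\<close>, which is the system for \<open>(m, c)\<close>; perturbing by concave kinks at
  the endpoints gives \<open>h(0) \<le> 0\<close> and \<open>h(1) \<le> 0\<close>. The former says that the replicon eigenvalue is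
  non-negative, the latter that \<open>\<nu>''/\<nu>' \<le> (c + m)/c\<close>. The ratio \<open>x = (c + m)/c\<close> is the only zero in
  \<open>(1, \<infinity>)\<close> of \<open>K(x) = x ln x - x + 1 - (x - 1)\<^sup>2/\<nu>'\<close>, which changes sign there from plus to minus, and
  \<open>K(\<nu>''/\<nu>')\<close> is a positive multiple of \<open>ABA\<close>.

  Conversely, if \<open>h(0) \<le> 0\<close> and \<open>h(1) \<le> 0\<close> then \<open>h\<close> is non-positive, non-negative, non-positive on
  successive intervals with end points \<open>a < b\<close>. A concave \<open>\<psi>\<close> lies above its chord through \<open>a\<close> and \<open>b\<close>
  exactly between these points, so \<open>h\<close> times the difference is non-negative, while \<open>h\<close> is
  orthogonal to the chord.
\<close>

section \<open>First-order conditions\<close>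

text \<open>The remainder is exact and has a sign: an upper bound on it gives the first variation of
  \<open>P0\<close>, dropping it gives convexity.\<close>

lemma inverse_taylor:
  fixes a b :: real
  assumes "a > 0" "b > 0"
  shows "1 / b = 1 / a - (b - a) / a^2 + (b - a)^2 / (a^2 * b)"
  using assms by (simp add: field_simps power2_eq_square)

text \<open>Expanding \<open>1 / x\<close> to second order bounds the change of \<open>P0\<close>
  from above by \<open>e * I + 2 / c^3 * e^2\<close>. Minimality makes this bound non-negative;
  dividing by \<open>e\<close> and letting \<open>e\<close> tend to 0 leaves
  \<open>0 \<le> I\<close>.\<close>

lemma minimizer_first_variation:
  fixes xi f phi :: "real \<Rightarrow> real"
  assumes min: "is_minimizer xi phi"
    and q: "continuous_on {0..1} (deriv (deriv xi))"
    and phi: "continuous_on {0..1} phi" "\<And>t. t \<in> {0..1} \<Longrightarrow> c \<le> phi t" and c: "c > 0"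
    and f: "continuous_on {0..1} f" "\<And>t. t \<in> {0..1} \<Longrightarrow> \<bar>f t\<bar> \<le> 1"
    and d: "d > 0" "\<And>e. 0 < e \<Longrightarrow> e < d \<Longrightarrow> (\<lambda>t. phi t + e * f t) \<in> classC"
  shows "0 \<le> integral {0..1} (\<lambda>t. (deriv (deriv xi) t - 1 / (phi t)^2) * f t)"
proof -
  define q where "q = deriv (deriv xi)"
  define I where "I = integral {0..1} (\<lambda>t. (q t - 1 / (phi t)^2) * f t)"
  have phipos: "phi t > 0" if "t \<in> {0..1}" for t
    using phi(2)[OF that] c by simp
  have cq: "continuous_on {0..1} q" using q by (simp add: q_def)
  \<comment> \<open>\<open>e < c/2\<close> keeps the perturbed function above \<open>c/2\<close>, so
    the denominator of the remainder is at least \<open>c^2 * (c/2)\<close>; hence the constant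
    \<open>2 / c^3\<close>.\<close>
  have key: "- (2 / c^3) * e \<le> I" if e: "0 < e" "e < min d (c/2)" for e
  proof -
    define psi where "psi = (\<lambda>t. phi t + e * f t)"
    have psi_ge: "c / 2 \<le> psi t" if t: "t \<in> {0..1}" for t
    proof -
      have "e * (- f t) \<le> e * 1" using f(2)[OF t] e by (intro mult_left_mono) auto
      then show ?thesis using phi(2)[OF t] e unfolding psi_def by simp
    qed
    have psipos: "psi t > 0" if "t \<in> {0..1}" for t
      using psi_ge[OF that] c by linarith
    have cpsi: "continuous_on {0..1} psi"
      unfolding psi_def by (intro continuous_intros phi f)
    have inv: "continuous_on {0..1} (\<lambda>x. 1 / phi x)" "continuous_on {0..1} (\<lambda>x. 1 / psi x)"
      using phipos psipos
      by (auto intro!: continuous_on_divide[OF continuous_on_const] phi cpsi simp: less_imp_neq[THEN not_sym])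
    have "P0 xi phi \<le> P0 xi psi"
      using min d(2) e unfolding is_minimizer_def psi_def by auto
    moreover have "P0 xi phi = ereal (integral {0..1} (\<lambda>x. q x * phi x + 1 / phi x))"
      unfolding P0_def q_def using phipos integrable_continuous_real[OF inv(1)] by auto
    moreover have "P0 xi psi = ereal (integral {0..1} (\<lambda>x. q x * psi x + 1 / psi x))"
      unfolding P0_def q_def using psipos integrable_continuous_real[OF inv(2)] by auto
    ultimately have le: "integral {0..1} (\<lambda>x. q x * phi x + 1 / phi x)
        \<le> integral {0..1} (\<lambda>x. q x * psi x + 1 / psi x)" by simp
    have c1: "continuous_on {0..1} (\<lambda>x. q x * phi x + 1 / phi x)"
      by (intro continuous_on_add inv continuous_on_mult cq phi)
    have c2: "continuous_on {0..1} (\<lambda>t. (q t - 1 / (phi t)^2) * f t)"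
      using phipos by (intro continuous_intros cq phi f) force
    have c3: "continuous_on {0..1} (\<lambda>x. q x * psi x + 1 / psi x)"
      by (intro continuous_on_add inv continuous_on_mult cq cpsi)
    have pw: "q t * psi t + 1 / psi t
        \<le> (q t * phi t + 1 / phi t) + e * ((q t - 1 / (phi t)^2) * f t) + 2 / c^3 * e^2"
      if t: "t \<in> {0..1}" for t
    proof -
      have p: "phi t > 0" "psi t > 0" using phipos psipos t by auto
      have "1 / psi t = 1 / phi t - e * f t / (phi t)^2 + (e * f t)^2 / ((phi t)^2 * psi t)"
        using inverse_taylor[OF p] unfolding psi_def by simp
      moreover have "(e * f t)^2 / ((phi t)^2 * psi t) \<le> (e^2) / (c^2 * (c/2))"
      proof (rule frac_le)
        have "(f t)^2 \<le> 1" using f(2)[OF t] by (simp add: abs_square_le_1)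
        then show "(e * f t)^2 \<le> e^2" by (simp add: power_mult_distrib mult_left_le)
        show "c^2 * (c/2) \<le> (phi t)^2 * psi t"
          using phi(2)[OF t] psi_ge[OF t] c by (intro mult_mono power_mono) auto
      qed (use c in auto)
      moreover have "(e^2) / (c^2 * (c/2)) = 2 / c^3 * e^2"
        using c by (simp add: field_simps power2_eq_square power3_eq_cube)
      ultimately have "1 / psi t \<le> 1 / phi t - e * f t / (phi t)^2 + 2 / c^3 * e^2" by linarith
      then show ?thesis
        by (simp add: psi_def algebra_simps)
    qed
    have i1: "((\<lambda>x. q x * phi x + 1 / phi x) has_integral
        integral {0..1} (\<lambda>x. q x * phi x + 1 / phi x)) {0..1}"
      using c1 by (intro integrable_integral integrable_continuous_real)
    have i2: "((\<lambda>t. (q t - 1 / (phi t)^2) * f t) has_integral I) {0..1}"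
      unfolding I_def using c2 by (intro integrable_integral integrable_continuous_real)
    have i3: "((\<lambda>t::real. 2 / c^3 * e^2) has_integral (2 / c^3 * e^2)) {0..1}"
      using has_integral_const_real[of "2 / c^3 * e^2" 0 1] by simp
    have "integral {0..1} (\<lambda>x. q x * psi x + 1 / psi x)
        \<le> integral {0..1} (\<lambda>x. q x * phi x + 1 / phi x) + e * I + 2 / c^3 * e^2"
      using has_integral_le[OF integrable_integral[OF integrable_continuous_real[OF c3]]
        has_integral_add[OF has_integral_add[OF i1 has_integral_mult_right[OF i2, of e]] i3]] pw
      by blast
    with le have "0 \<le> e * (I + 2 / c^3 * e)" by (simp add: algebra_simps power2_eq_square)
    then show ?thesis using e by (simp add: zero_le_mult_iff)
  qed
  have "((\<lambda>e. - (2 / c^3) * e) \<longlongrightarrow> - (2 / c^3) * 0) (at_right 0)"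
    by (intro tendsto_intros)
  moreover have "\<forall>\<^sub>F e in at_right 0. - (2 / c^3) * e \<le> I"
    using d(1) c by (intro eventually_at_rightI[of 0 "min d (c/2)"] key) auto
  ultimately have "- (2 / c^3) * 0 \<le> I"
    by (intro tendsto_upperbound) auto
  then show ?thesis by (simp add: I_def q_def)
qed

text \<open>Since the Taylor remainder of \<open>1 / x\<close> is non-negative, the linear term
  bounds the change of \<open>P0\<close> from below. If \<open>psi\<close> leaves the finite domain
  of \<open>P0\<close>, the right side is infinite.\<close>

lemma P0_le_if_first_variation_nonneg:
  fixes xi phi psi :: "real \<Rightarrow> real"
  assumes q: "continuous_on {0..1} (deriv (deriv xi))"
    and phi: "continuous_on {0..1} phi" "\<And>t. t \<in> {0..1} \<Longrightarrow> phi t > 0"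
    and psi: "continuous_on {0..1} psi"
    and nonneg: "0 \<le> integral {0..1} (\<lambda>t. (deriv (deriv xi) t - 1 / (phi t)^2) * (psi t - phi t))"
  shows "P0 xi phi \<le> P0 xi psi"
proof (cases "(\<forall>x\<in>{0..<1}. psi x > 0) \<and> (\<lambda>x. 1 / psi x) integrable_on {0..1}")
  case False
  then have "P0 xi psi = \<infinity>" unfolding P0_def by auto
  then show ?thesis by simp
next
  case True
  define q where "q = deriv (deriv xi)"
  have cq: "continuous_on {0..1} q" using q by (simp add: q_def)
  have inv: "continuous_on {0..1} (\<lambda>x. 1 / phi x)"
    using phi by (intro continuous_intros) force+
  have c1: "continuous_on {0..1} (\<lambda>x. q x * phi x + 1 / phi x)"
    by (intro continuous_on_add inv continuous_on_mult cq phi)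
  have c2: "continuous_on {0..1} (\<lambda>t. (q t - 1 / (phi t)^2) * (psi t - phi t))"
    using phi by (intro continuous_intros cq psi) force+
  have i3: "(\<lambda>x. q x * psi x + 1 / psi x) integrable_on {0..1}"
    using True by (intro integrable_add integrable_continuous_real[OF continuous_on_mult] cq psi) auto
  \<comment> \<open>\<open>psi\<close> may vanish at 1, where the convention
    \<open>1 / 0 = 0\<close> would break the pointwise bound; the point is removed as a null
    set.\<close>
  have spike: "(g has_integral y) {0..1} \<longleftrightarrow> (g has_integral y) ({0..1} - {1})"
    for g :: "real \<Rightarrow> real" and y
    by (rule has_integral_spike_set_eq) (auto intro: negligible_subset[of "{1}"])
  note i1 = integrable_integral[OF integrable_continuous_real[OF c1]]
  note i2 = integrable_integral[OF integrable_continuous_real[OF c2]]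
  have pw: "(q t * phi t + 1 / phi t) + (q t - 1 / (phi t)^2) * (psi t - phi t)
      \<le> q t * psi t + 1 / psi t" if t: "t \<in> {0..1} - {1}" for t
  proof -
    have p: "phi t > 0" "psi t > 0" using phi True t by auto
    then have "(psi t - phi t)^2 / ((phi t)^2 * psi t) \<ge> 0" by simp
    then show ?thesis using inverse_taylor[OF p] by (simp add: algebra_simps)
  qed
  have "integral {0..1} (\<lambda>x. q x * phi x + 1 / phi x)
      \<le> integral {0..1} (\<lambda>x. q x * phi x + 1 / phi x)
        + integral {0..1} (\<lambda>t. (q t - 1 / (phi t)^2) * (psi t - phi t))"
    using nonneg by (simp add: q_def)
  also have "\<dots> \<le> integral {0..1} (\<lambda>x. q x * psi x + 1 / psi x)"
  proof (rule has_integral_le)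
    show "((\<lambda>t. (q t * phi t + 1 / phi t) + (q t - 1 / (phi t)^2) * (psi t - phi t)) has_integral
       integral {0..1} (\<lambda>x. q x * phi x + 1 / phi x)
        + integral {0..1} (\<lambda>t. (q t - 1 / (phi t)^2) * (psi t - phi t))) ({0..1} - {1})"
      using has_integral_add[OF i1 i2] unfolding spike .
    show "((\<lambda>x. q x * psi x + 1 / psi x) has_integral
       integral {0..1} (\<lambda>x. q x * psi x + 1 / psi x)) ({0..1} - {1})"
      using integrable_integral[OF i3] unfolding spike .
  qed (use pw in blast)
  finally have le: "integral {0..1} (\<lambda>x. q x * phi x + 1 / phi x)
      \<le> integral {0..1} (\<lambda>x. q x * psi x + 1 / psi x)" .
  have "P0 xi phi = ereal (integral {0..1} (\<lambda>x. q x * phi x + 1 / phi x))"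
    unfolding P0_def q_def using phi integrable_continuous_real[OF inv] by auto
  moreover have "P0 xi psi = ereal (integral {0..1} (\<lambda>x. q x * psi x + 1 / psi x))"
    unfolding P0_def q_def using True by auto
  ultimately show ?thesis using le by simp
qed

section \<open>Sign patterns\<close>

text \<open>The pattern non-positive, non-negative, non-positive, with stretches possibly empty.
  Stated through three points, it needs no count of roots.\<close>

definition no_dip :: "(real \<Rightarrow> real) \<Rightarrow> bool" where
  "no_dip f \<longleftrightarrow> (\<forall>x y z. 0 \<le> x \<and> x < y \<and> y < z \<and> z \<le> 1 \<and> f x > 0 \<and> f z > 0 \<longrightarrow> f y \<ge> 0)"

text \<open>A dip of \<open>f\<close> forces, by the mean value theorem on three intervals, a dip of the derivative.\<close>

lemma no_dip_if_deriv_no_dip: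
  assumes f': "\<And>t. 0 \<le> t \<Longrightarrow> t \<le> 1 \<Longrightarrow> (f has_real_derivative f' t) (at t)"
    and nd: "no_dip f'" and f0: "f 0 \<le> 0"
  shows "no_dip f"
  unfolding no_dip_def
proof (intro allI impI, elim conjE, rule ccontr)
  fix x y z :: real
  assume xyz: "0 \<le> x" "x < y" "y < z" "z \<le> 1" and f: "f x > 0" "f z > 0" "\<not> f y \<ge> 0"
  have mvt: "\<exists>u>a. u < b \<and> f b - f a = (b - a) * f' u" if "0 \<le> a" "a < b" "b \<le> 1" for a b
    using that MVT2[of a b f f'] f' by force
  have "x > 0" using f0 f(1) xyz(1) by (cases "x = 0") auto
  then obtain u where u: "0 < u" "u < x" "f x - f 0 = (x - 0) * f' u"
    using mvt[of 0 x] xyz by auto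
  obtain v where v: "x < v" "v < y" "f y - f x = (y - x) * f' v"
    using mvt[of x y] xyz by auto
  obtain w where w: "y < w" "w < z" "f z - f y = (z - y) * f' w"
    using mvt[of y z] xyz by auto
  have "0 < (x - 0) * f' u" "(y - x) * f' v < 0" "0 < (z - y) * f' w"
    using u(3) v(3) w(3) f f0 by linarith+
  then have "f' u > 0" "f' v < 0" "f' w > 0"
    using xyz \<open>x > 0\<close> by (auto simp: zero_less_mult_iff mult_less_0_iff)
  then show False
    using nd u v w xyz unfolding no_dip_def by (smt (verit))
qed

text \<open>Orthogonality to affine functions allows a chord to be subtracted from
  \<open>psi\<close>. For the chord through the end points of the positivity set of
  \<open>h\<close>, the difference has the same sign as \<open>h\<close>.\<close>

lemma integral_mult_concave_nonneg:
  fixes h psi :: "real \<Rightarrow> real"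
  assumes h: "continuous_on {0..1} h" "no_dip h" "h 0 \<le> 0" "h 1 \<le> 0"
    and orth: "(h has_integral 0) {0..1}" "((\<lambda>t. h t * (1 - t)) has_integral 0) {0..1}"
    and psi: "continuous_on {0..1} psi" "concave_on {0..1} psi"
  shows "0 \<le> integral {0..1} (\<lambda>t. h t * psi t)"
proof (cases "\<exists>s\<in>{0..1}. h s > 0")
  case False
  have "((\<lambda>t. - h t) has_integral 0) {0..1}" using has_integral_neg[OF orth(1)] by simp
  then have z: "- h t = 0" if "t \<in> {0..1}" for t
    using has_integral_0_cbox_imp_0[of 0 1 "\<lambda>t. - h t" t] False h(1) that
    by (simp add: continuous_on_minus not_less)
  have "((\<lambda>t. h t * psi t) has_integral 0) {0..1}"
    using z by (intro has_integral_is_0) auto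
  then show ?thesis by (simp add: integral_unique)
next
  case True
  define S where "S = {s \<in> {0..1}. h s > 0}"
  define a b where "a = Inf S" and "b = Sup S"
  have ne: "S \<noteq> {}" and bd: "bdd_below S" "bdd_above S"
    using True unfolding S_def by (auto intro!: bdd_belowI[of _ 0] bdd_aboveI[of _ 1])
  have lo: "a \<le> s" and hi: "s \<le> b" if "s \<in> S" for s
    using that bd unfolding a_def b_def by (auto intro: cInf_lower cSup_upper)
  have ab01: "0 \<le> a" "b \<le> 1"
    using ne unfolding a_def b_def by (auto intro!: cInf_greatest cSup_least simp: S_def)
  have neg: "h t \<le> 0" if "t \<in> {0..1}" "t < a \<or> b < t" for t
    using lo[of t] hi[of t] that unfolding S_def by force
  have pos: "h t \<ge> 0" if t: "a < t" "t < b" for t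
  proof -
    obtain x where x: "x \<in> S" "x < t"
      using t(1) cInf_less_iff[OF ne bd(1), of t] unfolding a_def by blast
    obtain z where z: "z \<in> S" "t < z"
      using t(2) less_cSup_iff[OF ne bd(2), of t] unfolding b_def by blast
    show ?thesis using h(2) x z unfolding no_dip_def S_def by auto
  qed
  \<comment> \<open>A lone positive point would be interior by the signs at 0 and 1, with
    \<open>h \<le> 0\<close> just to its left, against continuity.\<close>
  have ab: "a < b"
  proof (rule ccontr)
    assume "\<not> a < b"
    obtain s where s: "s \<in> S" using ne by blast
    have eq: "a = s" "b = s" using lo[OF s] hi[OF s] \<open>\<not> a < b\<close> by auto
    have s01: "0 < s" "s < 1" "h s > 0" using s h(3,4) unfolding S_def
      by (metis (no_types, lifting) atLeastAtMost_iff leD less_eq_real_def mem_Collect_eq)+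
    have "isCont h s"
      using continuous_on_interior[OF h(1), of s] s01 by simp
    then have "(h \<longlongrightarrow> h s) (at_left s)"
      by (simp add: isCont_def filterlim_at_split)
    moreover have "\<forall>\<^sub>F t in at_left s. h t \<le> 0"
      using s01 eq neg by (intro eventually_at_leftI[of 0]) auto
    ultimately have "h s \<le> 0" by (intro tendsto_upperbound) auto
    with s01 show False by simp
  qed
  define k where "k = (psi b - psi a) / (b - a)"
  define l where "l = (\<lambda>t. psi a + k * (t - a))"
  have lb: "l b = psi b" and la: "l a = psi a" using ab unfolding l_def k_def by auto
  have chord: "psi y \<ge> psi x + (psi z - psi x) / (z - x) * (y - x)"
    if "0 \<le> x" "x \<le> y" "y \<le> z" "z \<le> 1" "x < z" for x y z
  proof -
    define u where "u = (y - x) / (z - x)"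
    have "u * (z - x) = y - x" using that by (simp add: u_def)
    then have "y = (1 - u) * x + u * z" by (simp add: algebra_simps)
    moreover have "0 \<le> u" "u \<le> 1" using that by (auto simp: u_def)
    ultimately have u: "0 \<le> u" "u \<le> 1" "y = (1 - u) * x + u * z" by auto
    have "psi ((1 - u) *\<^sub>R x + u *\<^sub>R z) \<ge> (1 - u) * psi x + u * psi z"
      using psi(2) u that by (intro concave_onD) auto
    then have "psi y \<ge> (1 - u) * psi x + u * psi z" using u(3) by simp
    also have "(1 - u) * psi x + u * psi z = psi x + (psi z - psi x) * u" by (simp add: algebra_simps)
    finally show ?thesis by (simp add: u_def)
  qed
  have prod: "h t * (psi t - l t) \<ge> 0" if t: "t \<in> {0..1}" for t
  proof -
    consider "t < a" | "t = a \<or> t = b" | "a < t" "t < b" | "b < t" by linarith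
    then show ?thesis
    proof cases
      \<comment> \<open>Outside \<open>[a, b]\<close> the chord inequality is applied with
        \<open>a\<close> (in case 4, \<open>b\<close>) as the middle point: beyond the chord a
        concave graph lies below the line.\<close>
      case 1
      have "psi a \<ge> psi t + (psi b - psi t) / (b - t) * (a - t)"
        using chord[of t a b] 1 t ab ab01 by auto
      then have "(psi a - psi t) * (b - t) \<ge> (psi b - psi t) * (a - t)"
        using 1 ab by (simp add: field_simps)
      then have "psi t * (b - a) \<le> psi a * (b - a) + (psi b - psi a) * (t - a)"
        by (simp add: algebra_simps)
      then have "psi t \<le> l t" using ab unfolding l_def k_def by (simp add: field_simps)
      then show ?thesis using neg[OF t] 1 by (simp add: mult_nonpos_nonpos)
    next
      case 2
      then show ?thesis using la lb by auto
    next
      case 3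
      have "psi t \<ge> l t" using chord[of a t b] 3 ab ab01 unfolding l_def k_def by auto
      then show ?thesis using pos[OF 3] by simp
    next
      case 4
      have "psi b \<ge> psi a + (psi t - psi a) / (t - a) * (b - a)"
        using chord[of a b t] 4 t ab ab01 by auto
      then have "(psi b - psi a) * (t - a) \<ge> (psi t - psi a) * (b - a)"
        using 4 ab by (simp add: field_simps)
      then have "psi t \<le> l t" using ab unfolding l_def k_def by (simp add: field_simps)
      then show ?thesis using neg[OF t] 4 by (simp add: mult_nonpos_nonpos)
    qed
  qed
  \<comment> \<open>The chord \<open>l\<close> is rewritten in terms of 1 and \<open>1 - t\<close>,
    the two functions to which \<open>h\<close> is orthogonal.\<close>
  have "((\<lambda>t. (psi a + k * (1 - a)) * h t - k * (h t * (1 - t))) has_integral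
      (psi a + k * (1 - a)) * 0 - k * 0) {0..1}"
    by (intro has_integral_diff has_integral_mult_right orth)
  then have il: "((\<lambda>t. h t * l t) has_integral 0) {0..1}"
    unfolding l_def by (simp add: algebra_simps)
  have "((\<lambda>t. h t * psi t) has_integral integral {0..1} (\<lambda>t. h t * psi t)) {0..1}"
    by (intro integrable_integral integrable_continuous_real continuous_on_mult h psi)
  from has_integral_diff[OF this il]
  have "((\<lambda>t. h t * (psi t - l t)) has_integral integral {0..1} (\<lambda>t. h t * psi t)) {0..1}"
    by (simp add: algebra_simps)
  then show ?thesis using prod by (rule has_integral_nonneg)
qed

section \<open>The stationarity system\<close>

text \<open>The function \<open>K\<close> of the introduction, with \<open>nu\<close> for the
  derivative of \<xi> at 1.\<close>

definition ratio_fun :: "real \<Rightarrow> real \<Rightarrow> real" where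
  "ratio_fun nu x = x * ln x - x + 1 - (x - 1)^2 / nu"

text \<open>The difference vanishes at 1 and has derivative
  \<open>(y - 1)^2 / (y * (y + 1)^2)\<close>. Both the monotonicity of the quotient below and the
  initial positivity of \<open>ratio_fun\<close> rest on this bound.\<close>

lemma ln_gt_rational:
  fixes x :: real
  assumes "x > 1"
  shows "2 * (x - 1) / (x + 1) < ln x"
proof -
  have "ln 1 - 2 * (1 - 1) / (1 + 1) < ln x - 2 * (x - 1) / (x + 1)"
  proof (rule DERIV_pos_imp_increasing_open[where f = "\<lambda>x. ln x - 2 * (x - 1) / (x + 1)"])
    fix y :: real assume y: "1 < y" "y < x"
    have "((\<lambda>x. ln x - 2 * (x - 1) / (x + 1)) has_real_derivative
        (y - 1)^2 / (y * (y + 1)^2)) (at y)"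
    proof (rule DERIV_cong)
      show "((\<lambda>x. ln x - 2 * (x - 1) / (x + 1)) has_real_derivative
          1 / y - (2 * (y + 1) - 2 * (y - 1)) / ((y + 1) * (y + 1))) (at y)"
        using y by (auto intro!: derivative_eq_intros)
      show "1 / y - (2 * (y + 1) - 2 * (y - 1)) / ((y + 1) * (y + 1)) = (y - 1)^2 / (y * (y + 1)^2)"
        using y by (simp add: divide_simps) (simp add: power2_eq_square algebra_simps)
    qed
    moreover have "(y - 1)^2 / (y * (y + 1)^2) > 0" using y by simp
    ultimately show "\<exists>z. ((\<lambda>x. ln x - 2 * (x - 1) / (x + 1)) has_real_derivative z) (at y) \<and> z > 0"
      by blast
  next
    show "continuous_on {1..x} (\<lambda>x. ln x - 2 * (x - 1) / (x + 1))"
      by (intro continuous_intros) auto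
  qed (use assms in auto)
  then show ?thesis by simp
qed

text \<open>The numerator of the derivative reduces to \<open>2 * (t - 1) - (t + 1) * ln t\<close>,
  negative by \<open>ln_gt_rational\<close>.\<close>

lemma ratio_quotient_decreasing:
  fixes x y :: real
  assumes "1 < x" "x < y"
  shows "(y * ln y - y + 1) / (y - 1)^2 < (x * ln x - x + 1) / (x - 1)^2"
proof (rule DERIV_neg_imp_decreasing[where f = "\<lambda>x. (x * ln x - x + 1) / (x - 1)^2"])
  fix t :: real assume "x \<le> t" "t \<le> y"
  then have t: "t > 1" using assms by simp
  have "((\<lambda>x. (x * ln x - x + 1) / (x - 1)^2) has_real_derivative
      (2 * (t - 1) - (t + 1) * ln t) / (t - 1)^3) (at t)"
  proof (rule DERIV_cong)
    show "((\<lambda>x. (x * ln x - x + 1) / (x - 1)^2) has_real_derivative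
        (ln t * (t - 1)^2 - (t * ln t - t + 1) * (2 * (t - 1))) / ((t - 1)^2 * (t - 1)^2)) (at t)"
      using t by (auto intro!: derivative_eq_intros)
    have "(ln t * (t - 1)^2 - (t * ln t - t + 1) * (2 * (t - 1)))
        = (t - 1) * (2 * (t - 1) - (t + 1) * ln t)"
      by (simp add: algebra_simps power2_eq_square)
    then show "(ln t * (t - 1)^2 - (t * ln t - t + 1) * (2 * (t - 1))) / ((t - 1)^2 * (t - 1)^2)
        = (2 * (t - 1) - (t + 1) * ln t) / (t - 1)^3"
      using t by (simp add: power2_eq_square power3_eq_cube)
  qed
  moreover have "(2 * (t - 1) - (t + 1) * ln t) / (t - 1)^3 < 0"
    using ln_gt_rational[OF t] t by (simp add: divide_less_0_iff field_simps)
  ultimately show "\<exists>z. ((\<lambda>x. (x * ln x - x + 1) / (x - 1)^2) has_real_derivative z) (at t) \<and> z < 0"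
    by blast
qed (use assms in auto)

text \<open>Dividing \<open>ratio_fun nu\<close> by \<open>(x - 1)^2\<close> leaves a strictly
  decreasing quotient minus the constant \<open>1 / nu\<close>, which settles uniqueness and signs.
  Existence is the intermediate value theorem between \<open>nu - 1\<close> and
  \<open>(2 * nu)^2\<close>.\<close>

lemma ratio_fun_root:
  assumes nu: "nu > 2"
  obtains x0 where "x0 > 1" "ratio_fun nu x0 = 0"
    "\<And>x. x > 1 \<Longrightarrow> ratio_fun nu x = 0 \<Longrightarrow> x = x0"
    "\<And>x. x > 1 \<Longrightarrow> 0 \<le> ratio_fun nu x \<longleftrightarrow> x \<le> x0"
proof -
  define g where "g = (\<lambda>x::real. (x * ln x - x + 1) / (x - 1)^2)"
  have K: "ratio_fun nu x = (x - 1)^2 * (g x - 1 / nu)" if "x > 1" for x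
    using that nu unfolding ratio_fun_def g_def by (simp add: field_simps)
  have cont: "continuous_on {a..b} (ratio_fun nu)" if "a \<ge> 1" for a b
    using that nu unfolding ratio_fun_def by (intro continuous_intros) auto
  \<comment> \<open>Up to \<open>nu - 1\<close> one has \<open>y + 1 \<le> nu\<close>, so the
    derivative \<open>ln y - 2 * (y - 1) / nu\<close> is positive by
    \<open>ln_gt_rational\<close>.\<close>
  have pos: "ratio_fun nu (nu - 1) > 0"
  proof -
    have "ratio_fun nu 1 < ratio_fun nu (nu - 1)"
    proof (rule DERIV_pos_imp_increasing_open[where f = "ratio_fun nu"])
      fix y assume y: "1 < y" "y < nu - 1"
      have "(ratio_fun nu has_real_derivative (ln y - 2 * (y - 1) / nu)) (at y)"
        unfolding ratio_fun_def using y nu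
        by (auto intro!: derivative_eq_intros)
      moreover have "2 * (y - 1) / nu \<le> 2 * (y - 1) / (y + 1)"
        using y by (intro divide_left_mono) auto
      then have "ln y - 2 * (y - 1) / nu > 0" using ln_gt_rational[OF y(1)] by linarith
      ultimately show "\<exists>z. (ratio_fun nu has_real_derivative z) (at y) \<and> z > 0" by blast
    qed (use nu cont in auto)
    then show ?thesis by (simp add: ratio_fun_def)
  qed
  \<comment> \<open>At a square \<open>s^2\<close> the logarithm is at most
    \<open>2 * (s - 1)\<close>, so the quadratic term wins for large \<open>s\<close>;
    \<open>s = 2 * nu\<close> suffices, the remaining factor being
    \<open>- 3 - 1 / nu\<close>.\<close>
  have neg: "ratio_fun nu ((2 * nu)^2) < 0"
  proof -
    define s where "s = 2 * nu"
    have s: "s > 4" using nu by (simp add: s_def)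
    have "ln (s^2) = 2 * ln s" using s by (simp add: ln_realpow)
    also have "\<dots> \<le> 2 * (s - 1)" using s ln_le_minus_one[of s] by simp
    finally have "s^2 * ln (s^2) \<le> s^2 * (2 * (s - 1))" by (intro mult_left_mono) auto
    then have "ratio_fun nu (s^2) \<le> s^2 * (2 * (s - 1)) - s^2 + 1 - (s^2 - 1)^2 / nu"
      unfolding ratio_fun_def by simp
    also have "\<dots> = (s - 1)^2 * ((2 * s + 1) - (s + 1)^2 / nu)"
      using nu by (simp add: field_simps power2_eq_square)
    also have "\<dots> < 0"
    proof -
      have "(2 * s + 1) - (s + 1)^2 / nu = - 3 - 1 / nu"
        using nu unfolding s_def by (simp add: field_simps power2_eq_square)
      also have "\<dots> < 0" using nu by (smt (verit) divide_pos_pos)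
      finally show ?thesis using s by (intro mult_pos_neg) auto
    qed
    finally show ?thesis by (simp add: s_def)
  qed
  have le: "nu - 1 \<le> (2 * nu)^2"
  proof -
    have "nu * 1 \<le> nu * (4 * nu)" using nu by (intro mult_left_mono) auto
    then show ?thesis by (simp add: power2_eq_square)
  qed
  obtain x0 where x0: "nu - 1 \<le> x0" "ratio_fun nu x0 = 0"
    using IVT2'[of "ratio_fun nu" "(2 * nu)^2" 0 "nu - 1"] pos neg le cont nu by auto
  have x1: "x0 > 1" using x0 nu by simp
  have gx0: "g x0 = 1 / nu" using K[OF x1] x0 x1 by simp
  have dec: "g y < g x" if "1 < x" "x < y" for x y
    unfolding g_def using that by (rule ratio_quotient_decreasing)
  have iff: "0 \<le> ratio_fun nu x \<longleftrightarrow> x \<le> x0" and eq: "ratio_fun nu x = 0 \<longrightarrow> x = x0"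
    if x: "x > 1" for x
  proof -
    have "(x - 1)^2 > 0" using x by simp
    then have s: "0 \<le> ratio_fun nu x \<longleftrightarrow> g x0 \<le> g x" "ratio_fun nu x = 0 \<longleftrightarrow> g x = g x0"
      unfolding K[OF x] gx0 by (auto simp: zero_le_mult_iff)
    show "0 \<le> ratio_fun nu x \<longleftrightarrow> x \<le> x0" "ratio_fun nu x = 0 \<longrightarrow> x = x0"
      unfolding s using dec[of x x0] dec[of x0 x] x x1 by (cases x x0 rule: linorder_cases; force)+
  qed
  show thesis using that[OF x1 x0(2)] iff eq by blast
qed

text \<open>The system of \<open>mc_sol\<close> for \<xi>(1) = 1; it then involves \<xi> only
  through its derivative \<open>nu\<close> at 1.\<close>

definition stationary :: "real \<Rightarrow> real \<Rightarrow> real \<Rightarrow> bool" where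
  "stationary nu m c \<longleftrightarrow> 1 = (1 / m) * ((1 / m) * ln ((c + m) / c) - 1 / (c + m)) \<and>
     1 / nu = c * (c + m)"

text \<open>The second equation replaces \<open>1 / nu\<close> in \<open>ratio_fun\<close> by
  \<open>c * (c + m)\<close>; clearing denominators then gives the first. This separates the ratio
  \<open>(c + m) / c\<close> from the scale \<open>c\<close>.\<close>

lemma stationary_iff_ratio:
  assumes "m > 0" "c > 0" "nu > 0"
  shows "stationary nu m c \<longleftrightarrow> 1 / nu = c * (c + m) \<and> ratio_fun nu ((c + m) / c) = 0"
proof (cases "1 / nu = c * (c + m)")
  case True
  define L where "L = ln ((c + m) / c)"
  have "1 = (1 / m) * ((1 / m) * L - 1 / (c + m)) \<longleftrightarrow> m^2 * (c + m) = (c + m) * L - m"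
  proof -
    have "(1 / m) * ((1 / m) * L - 1 / s) = (s * L - m) / (m^2 * s)" if "s > 0" for s
      using assms that by (simp add: field_simps power2_eq_square)
    from this[of "c + m"]
    have "(1 / m) * ((1 / m) * L - 1 / (c + m)) = ((c + m) * L - m) / (m^2 * (c + m))"
      using assms by simp
    then show ?thesis
      using assms by (simp add: eq_divide_eq[of 1] mult.commute)
  qed
  moreover have "ratio_fun nu ((c + m) / c) = ((c + m) * L - m - m^2 * (c + m)) / c"
  proof -
    have "ratio_fun nu ((c + m) / c) = (c + m) / c * L - (c + m) / c + 1 - ((c + m) / c - 1)^2 * (c * (c + m))"
      unfolding ratio_fun_def L_def True[symmetric] by simp
    also have "\<dots> = ((c + m) * L - m - m^2 * (c + m)) / c"
      using assms by (simp add: field_simps power2_eq_square)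
    finally show ?thesis .
  qed
  ultimately show ?thesis
    using True assms unfolding stationary_def L_def[symmetric] by auto
qed (simp add: stationary_def)

text \<open>The ratio is the unique root \<open>x0\<close>, and \<open>1 / nu = c^2 * x0\<close>
  then fixes \<open>c\<close>.\<close>

lemma stationary_unique:
  assumes "nu > 2" "m > 0" "c > 0" "stationary nu m c" "m' > 0" "c' > 0" "stationary nu m' c'"
  shows "m' = m \<and> c' = c"
proof -
  obtain x0 where x0: "x0 > 1" "\<And>x. x > 1 \<Longrightarrow> ratio_fun nu x = 0 \<Longrightarrow> x = x0"
    using ratio_fun_root[OF assms(1)] by metis
  have r: "c + m = x0 * c" "1 / nu = c * (c + m)" if "m > 0" "c > 0" "stationary nu m c" for m c
  proof -
    have "1 / nu = c * (c + m)" "ratio_fun nu ((c + m) / c) = 0"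
      using that stationary_iff_ratio[of m c nu] assms(1) by auto
    moreover from this(2) have "(c + m) / c = x0" using that by (intro x0(2)) auto
    ultimately show "c + m = x0 * c" "1 / nu = c * (c + m)" using that by auto
  qed
  have "c^2 * x0 = c'^2 * x0"
    using r[OF assms(2-4)] r[OF assms(5-7)] by (auto simp: power2_eq_square mult.commute mult.left_commute)
  then have "c' = c" using x0(1) assms by simp
  then show ?thesis using r(1)[OF assms(2-4)] r(1)[OF assms(5-7)] by simp
qed

lemma stationary_exists:
  assumes "nu > 2"
  obtains m c where "m > 0" "c > 0" "stationary nu m c"
proof -
  obtain x0 where x0: "x0 > 1" "ratio_fun nu x0 = 0" using ratio_fun_root[OF assms] by metis
  \<comment> \<open>This solves \<open>1 / nu = c^2 * x0\<close>; \<open>m\<close> then makes the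
    ratio equal to \<open>x0\<close>.\<close>
  define c where "c = 1 / sqrt (nu * x0)"
  define m where "m = c * (x0 - 1)"
  have c: "c > 0" "c^2 = 1 / (nu * x0)" using x0 assms unfolding c_def by (auto simp: power_divide)
  have cm: "c + m = c * x0" unfolding m_def by (simp add: algebra_simps)
  have "c * (c + m) = c^2 * x0" unfolding cm by (simp add: power2_eq_square)
  also have "\<dots> = 1 / nu" unfolding c(2) using x0 assms by simp
  finally have "1 / nu = c * (c + m)" by simp
  moreover have "(c + m) / c = x0" using c cm by simp
  moreover have "m > 0" using c x0 unfolding m_def by simp
  ultimately show thesis using that[of m c] c x0 assms stationary_iff_ratio[of m c nu] by auto
qed

lemma mc_sol_eq:
  assumes "xi 1 = 1" "deriv xi 1 > 2" "m > 0" "c > 0" "stationary (deriv xi 1) m c"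
  shows "mc_sol xi = (m, c)"
proof -
  have "mc_sol xi = (THE (m, c). m > 0 \<and> c > 0 \<and> stationary (deriv xi 1) m c)"
    unfolding mc_sol_def stationary_def assms(1) ..
  also have "\<dots> = (m, c)"
  proof (rule the_equality)
    show "case (m, c) of (m, c) \<Rightarrow> m > 0 \<and> c > 0 \<and> stationary (deriv xi 1) m c"
      using assms by simp
  next
    fix z assume "case z of (m, c) \<Rightarrow> m > 0 \<and> c > 0 \<and> stationary (deriv xi 1) m c"
    then show "z = (m, c)"
      using stationary_unique[OF assms(2-5), of "fst z" "snd z"] by (simp add: case_prod_beta prod_eq_iff)
  qed
  finally show ?thesis .
qed

section \<open>Affine order parameters\<close>

text \<open>These moments of \<open>1 / \<phi>\<^sup>2\<close> are where the right-hand sides of the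
  system come from.\<close>

lemma affine_weight_integrals:
  fixes m c :: real
  assumes "m > 0" "c > 0"
  shows "((\<lambda>t. 1 / (c + m * (1 - t))^2) has_integral 1 / (c * (c + m))) {0..1}"
    and "((\<lambda>t. 1 / (c + m * (1 - t))^2 * (1 - t)) has_integral
      (1 / m) * ((1 / m) * ln ((c + m) / c) - 1 / (c + m))) {0..1}"
proof -
  have pos: "c + m * (1 - t) > 0" if "t \<in> {0..1}" for t
    using that assms by (auto intro: add_pos_nonneg)
  have "((\<lambda>t. 1 / (c + m * (1 - t))^2) has_integral
      1 / (m * (c + m * (1 - 1))) - 1 / (m * (c + m * (1 - 0)))) {0..1}"
  proof (rule fundamental_theorem_of_calculus)
    fix t :: real assume t: "t \<in> {0..1}"
    show "((\<lambda>t. 1 / (m * (c + m * (1 - t)))) has_vector_derivative 1 / (c + m * (1 - t))^2) (at t within {0..1})"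
      unfolding has_real_derivative_iff_has_vector_derivative[symmetric]
      using pos[OF t] assms by (auto intro!: derivative_eq_intros simp: power2_eq_square divide_simps)
  qed simp
  moreover have "1 / (m * c) - 1 / (m * s) = (s - c) / (m * (c * s))" if "s > 0" for s
    using assms that by (simp add: field_simps)
  from this[of "c + m"]
  have "1 / (m * (c + m * (1 - 1))) - 1 / (m * (c + m * (1 - 0))) = 1 / (c * (c + m))"
    using assms by simp
  ultimately show "((\<lambda>t. 1 / (c + m * (1 - t))^2) has_integral 1 / (c * (c + m))) {0..1}" by simp
  \<comment> \<open>With \<open>u = c + m * (1 - t)\<close> the integrand is
    \<open>(u - c) / (m * u^2)\<close>, whose antiderivative in \<open>t\<close> is
    \<open>F\<close>.\<close>
  define F where "F = (\<lambda>t. - (1 / m^2) * (ln (c + m * (1 - t)) + c / (c + m * (1 - t))))"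
  have "((\<lambda>t. 1 / (c + m * (1 - t))^2 * (1 - t)) has_integral F 1 - F 0) {0..1}"
  proof (rule fundamental_theorem_of_calculus)
    fix t :: real assume t: "t \<in> {0..1}"
    define u where "u = c + m * (1 - t)"
    have "(F has_real_derivative - (1 / m^2) * (- m / u + c * m / u^2)) (at t within {0..1})"
      unfolding F_def using pos[OF t] assms
      by (auto intro!: derivative_eq_intros simp: u_def power2_eq_square)
    moreover have "- (1 / m^2) * (- m / u + c * m / u^2) = 1 / u^2 * (1 - t)"
    proof -
      have "u \<noteq> 0" "m \<noteq> 0" using pos[OF t] assms by (auto simp: u_def)
      then have "- (1 / m^2) * (- m / u + c * m / u^2) = (u - c) / (m * u^2)"
        by (simp add: field_simps power2_eq_square)
      also have "u - c = m * (1 - t)" by (simp add: u_def)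
      finally show ?thesis using assms by simp
    qed
    ultimately show "(F has_vector_derivative 1 / (c + m * (1 - t))^2 * (1 - t)) (at t within {0..1})"
      unfolding has_real_derivative_iff_has_vector_derivative[symmetric] u_def by simp
  qed simp
  moreover have "F 1 - F 0 = (1 / m) * ((1 / m) * ln ((c + m) / c) - 1 / (c + m))"
  proof -
    have "F 1 - F 0 = (1 / m^2) * (ln (c + m) + c / (c + m) - ln c - 1)"
      using assms unfolding F_def by (simp add: algebra_simps)
    also have "c / (c + m) = 1 - m / (c + m)" using assms by (simp add: field_simps)
    also have "(1 / m^2) * (ln (c + m) + (1 - m / (c + m)) - ln c - 1)
        = (1 / m) * ((1 / m) * (ln (c + m) - ln c) - 1 / (c + m))"
      using assms by (simp add: algebra_simps power2_eq_square)
    finally show ?thesis using assms by (simp add: ln_div)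
  qed
  ultimately show "((\<lambda>t. 1 / (c + m * (1 - t))^2 * (1 - t)) has_integral
      (1 / m) * ((1 / m) * ln ((c + m) / c) - 1 / (c + m))) {0..1}" by simp
qed

lemma concave_on_affine: "concave_on {0..1::real} (\<lambda>t. a + b * t)"
  unfolding concave_on_iff
proof (intro conjI ballI allI impI)
  fix x y u v :: real assume "u + v = 1"
  then have v: "v = 1 - u" by simp
  show "u * (a + b * x) + v * (a + b * y) \<le> a + b * (u *\<^sub>R x + v *\<^sub>R y)"
    unfolding v by (simp add: algebra_simps)
qed simp

text \<open>\<open>e < c\<close> protects the sign and \<open>e < m\<close> the monotonicity, as
  \<open>f\<close> is bounded by 1 and 1-Lipschitz. So \<open>f\<close> itself need be neither
  non-negative nor monotone.\<close>

lemma affine_perturbation_in_classC: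
  assumes mc: "m > 0" "c > 0" and e: "0 \<le> e" "e < m" "e < c"
    and f: "concave_on {0..1} f" "\<And>x y. \<bar>f x - f y\<bar> \<le> \<bar>x - y\<bar>" "\<And>t. t \<in> {0..1} \<Longrightarrow> \<bar>f t\<bar> \<le> 1"
  shows "(\<lambda>t. c + m * (1 - t) + e * f t) \<in> classC"
proof -
  have cf: "continuous_on {0..1} f"
    by (rule lipschitz_on_continuous_on[of 1], rule lipschitz_onI)
       (use f(2) in \<open>auto simp: dist_real_def\<close>)
  have "c + m * (1 - t) + e * f t \<ge> 0" if t: "t \<in> {0..1}" for t
  proof -
    have "e * (- f t) \<le> e * 1" using f(3)[OF t] e by (intro mult_left_mono) auto
    moreover have "m * (1 - t) \<ge> 0" using mc t by simp
    ultimately show ?thesis using e by simp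
  qed
  moreover have "c + m * (1 - y) + e * f y \<le> c + m * (1 - x) + e * f x" if "x \<le> y" for x y
  proof -
    have "e * (f y - f x) \<le> e * (y - x)" using f(2)[of y x] e that by (intro mult_left_mono) auto
    also have "\<dots> \<le> m * (y - x)" using e that by (intro mult_right_mono) auto
    finally have "e * (f y - f x) \<le> m * (y - x)" .
    then show ?thesis by (simp add: algebra_simps)
  qed
  moreover have "concave_on {0..1} (\<lambda>t. c + m * (1 - t) + e * f t)"
  proof -
    have "concave_on {0..1} (\<lambda>t. e * f t)"
      using e(1) f(1) by (rule concave_on_cmul)
    moreover have "concave_on {0..1} (\<lambda>t::real. c + m * (1 - t))"
      using concave_on_affine[of "c + m" "- m"] by (simp add: algebra_simps)
    ultimately show ?thesis using concave_on_add by blast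
  qed
  moreover have "continuous_on {0..1} (\<lambda>t. c + m * (1 - t) + e * f t)"
    by (intro continuous_intros cf)
  ultimately show ?thesis unfolding classC_def by auto
qed

lemma affine_minimizer_variation:
  assumes min: "is_minimizer xi (\<lambda>t. c + m * (1 - t))" and mc: "m > 0" "c > 0"
    and q: "continuous_on {0..1} (deriv (deriv xi))"
    and f: "concave_on {0..1} f" "\<And>x y. \<bar>f x - f y\<bar> \<le> \<bar>x - y\<bar>" "\<And>t. t \<in> {0..1} \<Longrightarrow> \<bar>f t\<bar> \<le> 1"
  shows "0 \<le> integral {0..1} (\<lambda>t. (deriv (deriv xi) t - 1 / (c + m * (1 - t))^2) * f t)"
proof (rule minimizer_first_variation[OF min q, of c _ "min m c"])
  show "continuous_on {0..1} f"
    by (rule lipschitz_on_continuous_on[of 1], rule lipschitz_onI)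
       (use f(2) in \<open>auto simp: dist_real_def\<close>)
  show "(\<lambda>t. c + m * (1 - t) + e * f t) \<in> classC" if "0 < e" "e < min m c" for e
    using affine_perturbation_in_classC[OF mc _ _ _ f] that by simp
qed (use mc f(3) in \<open>auto intro!: continuous_intros\<close>)

lemma integral_pos_if_continuous_nonneg:
  fixes k :: "real \<Rightarrow> real"
  assumes "continuous_on {0..1} k" "\<And>t. t \<in> {0..1} \<Longrightarrow> 0 \<le> k t" "t0 \<in> {0..1}" "k t0 > 0"
  shows "0 < integral {0..1} k"
proof -
  have i: "(k has_integral integral {0..1} k) {0..1}"
    using assms(1) by (intro integrable_integral integrable_continuous_real)
  have "0 \<le> integral {0..1} k" using has_integral_nonneg[OF i] assms(2) by blast
  moreover have "integral {0..1} k \<noteq> 0"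
  proof
    assume "integral {0..1} k = 0"
    then have "k t0 = 0"
      using has_integral_0_cbox_imp_0[of 0 1 k t0] i assms by simp
    then show False using assms(4) by simp
  qed
  ultimately show ?thesis by simp
qed

section \<open>The mixed model\<close>

text \<open>For positive \<open>n\<close> the derivative is a power of \<open>t\<close> times a
  non-increasing affine function, which has no dip, and the value at 0 is
  \<open>- \<gamma>\<close>.\<close>

lemma no_dip_hump:
  assumes "\<beta> \<ge> 0" "\<gamma> \<ge> 0"
  shows "no_dip (\<lambda>t. t^n * (\<alpha> - \<beta> * t) - \<gamma>)"
proof (cases n)
  \<comment> \<open>Here the value at 0 may be positive, so the derivative criterion is replaced by
    monotonicity.\<close>
  case 0
  have "\<alpha> - \<beta> * y - \<gamma> \<ge> 0" if "y < z" "\<alpha> - \<beta> * z - \<gamma> > 0" for y z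
    using that assms mult_left_mono[of y z \<beta>] by linarith
  then show ?thesis unfolding no_dip_def 0 by force
next
  case (Suc k)
  show ?thesis
  proof (rule no_dip_if_deriv_no_dip)
    show "((\<lambda>t. t^n * (\<alpha> - \<beta> * t) - \<gamma>) has_real_derivative
        t^k * (real n * \<alpha> - (real n + 1) * \<beta> * t)) (at t)" for t
      unfolding Suc by (rule derivative_eq_intros refl)+ (simp add: algebra_simps)
    show "no_dip (\<lambda>t. t^k * (real n * \<alpha> - (real n + 1) * \<beta> * t))"
      unfolding no_dip_def
    proof (intro allI impI, elim conjE)
      fix x y z :: real
      assume xyz: "0 \<le> x" "x < y" "y < z" and pos: "0 < z^k * (real n * \<alpha> - (real n + 1) * \<beta> * z)"
      have "z^k > 0" using xyz by simp
      then have "real n * \<alpha> - (real n + 1) * \<beta> * z > 0" using pos by (rule zero_less_mult_pos[rotated])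
      moreover have "(real n + 1) * \<beta> * y \<le> (real n + 1) * \<beta> * z"
        using xyz assms by (intro mult_left_mono) auto
      ultimately show "0 \<le> y^k * (real n * \<alpha> - (real n + 1) * \<beta> * y)"
        using xyz by (intro mult_nonneg_nonneg zero_le_power) linarith+
    qed
    show "0^n * (\<alpha> - \<beta> * 0) - \<gamma> \<le> 0" using Suc assms by simp
  qed
qed

lemma no_dip_cong_sgn:
  assumes "no_dip f" "\<And>t. t \<in> {0..1} \<Longrightarrow> sgn (g t) = sgn (f t)"
  shows "no_dip g"
proof -
  have "0 < g t \<longleftrightarrow> 0 < f t" "0 \<le> g t \<longleftrightarrow> 0 \<le> f t" if "t \<in> {0..1}" for t
    using assms(2)[OF that] by (metis sgn_greater, metis sgn_less not_less)
  note sign = this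
  show ?thesis
    unfolding no_dip_def
  proof (intro allI impI, elim conjE)
    fix x y z assume xyz: "0 \<le> x" "x < y" "y < z" "z \<le> 1" "0 < g x" "0 < g z"
    then have "0 < f x" "0 < f z" using sign(1)[of x] sign(1)[of z] by auto
    then have "0 \<le> f y" using assms(1) xyz unfolding no_dip_def by blast
    then show "0 \<le> g y" using sign(2)[of y] xyz by simp
  qed
qed

text \<open>The sign of the gap is that of \<open>\<xi>'' \<phi>\<^sup>2 - 1\<close>, whose derivative is \<open>\<phi>\<close> times a hump.\<close>

lemma no_dip_gap:
  fixes A mu m c :: real and n :: nat
  defines "q \<equiv> \<lambda>t. 2 * mu + A * t^(n + 1)"
  assumes mc: "m > 0" "c > 0" and mu: "mu \<ge> 0" "A \<ge> 0"
    and h0: "q 0 - 1 / (c + m * (1 - 0))^2 \<le> 0"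
  shows "no_dip (\<lambda>t. q t - 1 / (c + m * (1 - t))^2)"
proof -
  define phi where "phi = (\<lambda>t. c + m * (1 - t))"
  \<comment> \<open>\<open>R\<close> is \<open>q' * phi - 2 * m * q\<close>, the derivative of
    \<open>q * phi^2 - 1\<close> divided by \<open>phi\<close>, sorted by powers of
    \<open>t\<close>.\<close>
  define R where "R = (\<lambda>t. t^n * (A * (n + 1) * (c + m) - m * A * (n + 3) * t) - 4 * m * mu)"
  have pos: "phi t > 0" if "t \<in> {0..1}" for t
    using that mc unfolding phi_def by (auto intro: add_pos_nonneg)
  have sgn_h: "sgn (q t - 1 / (phi t)^2) = sgn (q t * (phi t)^2 - 1)" if "t \<in> {0..1}" for t
  proof -
    have "q t * (phi t)^2 - 1 = (phi t)^2 * (q t - 1 / (phi t)^2)"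
      using pos[OF that] by (simp add: field_simps)
    then show ?thesis using pos[OF that] by (simp add: sgn_mult)
  qed
  have "no_dip R"
    unfolding R_def using mc mu by (intro no_dip_hump) auto
  then have "no_dip (\<lambda>t. phi t * R t)"
    by (rule no_dip_cong_sgn) (use pos in \<open>auto simp: sgn_mult\<close>)
  note nd = this
  have der: "((\<lambda>t. q t * (phi t)^2 - 1) has_real_derivative phi t * R t) (at t)" for t
  proof -
    have "((\<lambda>t. q t * (phi t)^2 - 1) has_real_derivative
        A * ((n + 1) * t^n) * (phi t)^2 + q t * (2 * phi t * (- m))) (at t)"
      unfolding q_def phi_def by (rule derivative_eq_intros refl)+ (simp add: algebra_simps)
    also have "A * ((n + 1) * t^n) * (phi t)^2 + q t * (2 * phi t * (- m))
        = phi t * (A * ((n + 1) * t^n) * (c + m * (1 - t)) - 2 * m * q t)"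
      unfolding phi_def by (simp add: algebra_simps power2_eq_square)
    also have "A * ((n + 1) * t^n) * (c + m * (1 - t)) - 2 * m * q t = R t"
      unfolding q_def R_def by (simp add: algebra_simps)
    finally show ?thesis .
  qed
  have "q 0 * (phi 0)^2 - 1 \<le> 0"
    using sgn_h[of 0] h0 unfolding phi_def by (metis atLeastAtMost_iff not_less order_refl sgn_greater zero_le_one)
  with der nd have "no_dip (\<lambda>t. q t * (phi t)^2 - 1)"
    by (rule no_dip_if_deriv_no_dip)
  then have "no_dip (\<lambda>t. q t - 1 / (phi t)^2)"
    by (rule no_dip_cong_sgn) (use sgn_h in auto)
  then show ?thesis by (simp add: phi_def)
qed

section \<open>Derivatives and moments of the mixture\<close>

lemma deriv_xi_mix:
  "deriv (xi_mix mu (n + 3)) = (\<lambda>t. 2 * mu * t + (1 - mu) * (real n + 3) * t^(n + 2))"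
  "deriv (deriv (xi_mix mu (n + 3))) = (\<lambda>t. 2 * mu + (1 - mu) * (real n + 3) * (real n + 2) * t^(n + 1))"
proof -
  show 1: "deriv (xi_mix mu (n + 3)) = (\<lambda>t. 2 * mu * t + (1 - mu) * (real n + 3) * t^(n + 2))"
    unfolding xi_mix_def
    by (intro ext DERIV_imp_deriv, (rule derivative_eq_intros refl)+)
       (simp add: algebra_simps power_add eval_nat_numeral)
  show "deriv (deriv (xi_mix mu (n + 3))) = (\<lambda>t. 2 * mu + (1 - mu) * (real n + 3) * (real n + 2) * t^(n + 1))"
    unfolding 1
    by (intro ext DERIV_imp_deriv, (rule derivative_eq_intros refl)+) (simp add: algebra_simps)
qed

text \<open>Integration by parts, using that \<xi> and its derivative vanish at 0 and that \<xi>(1)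
  = 1.\<close>

lemma xi_mix_integrals:
  fixes n :: nat and mu :: real
  defines "q \<equiv> deriv (deriv (xi_mix mu (n + 3)))"
  shows "(q has_integral deriv (xi_mix mu (n + 3)) 1) {0..1}"
    and "((\<lambda>t. q t * (1 - t)) has_integral 1) {0..1}"
proof -
  define d where "d = deriv (xi_mix mu (n + 3))"
  have d': "(d has_real_derivative q t) (at t)" for t
    unfolding d_def q_def deriv_xi_mix(2) unfolding deriv_xi_mix(1)
    by (rule derivative_eq_intros refl)+ (simp add: algebra_simps)
  have xi': "(xi_mix mu (n + 3) has_real_derivative d t) (at t)" for t
    unfolding d_def deriv_xi_mix(1) unfolding xi_mix_def
    by (rule derivative_eq_intros refl)+ (simp add: algebra_simps power_add eval_nat_numeral)
  have "(q has_integral d 1 - d 0) {0..1}"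
    by (rule fundamental_theorem_of_calculus)
       (auto simp flip: has_real_derivative_iff_has_vector_derivative
             intro: DERIV_subset[OF d'])
  moreover have d0: "d 0 = 0" unfolding d_def deriv_xi_mix by simp
  ultimately show "(q has_integral deriv (xi_mix mu (n + 3)) 1) {0..1}" by (simp add: d_def)
  have "((\<lambda>t. d t * (1 - t) + xi_mix mu (n + 3) t) has_real_derivative q t * (1 - t)) (at t)" for t
    by (auto intro!: derivative_eq_intros d' xi')
  then have "((\<lambda>t. q t * (1 - t)) has_integral
      (d 1 * (1 - 1) + xi_mix mu (n + 3) 1) - (d 0 * (1 - 0) + xi_mix mu (n + 3) 0)) {0..1}"
    by (intro fundamental_theorem_of_calculus)
       (auto simp flip: has_real_derivative_iff_has_vector_derivative intro: DERIV_subset)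
  then show "((\<lambda>t. q t * (1 - t)) has_integral 1) {0..1}"
    using d0 by (simp add: xi_mix_def zero_power)
qed

section \<open>The two spectral conditions as signs of the gap at 0 and 1\<close>

lemma ABA_nonneg_iff:
  assumes "deriv xi 1 > 0" "deriv (deriv xi) 1 > 0"
  shows "ABA xi \<ge> 0 \<longleftrightarrow> ratio_fun (deriv xi 1) (deriv (deriv xi) 1 / deriv xi 1) \<ge> 0"
proof -
  define a y where "a = deriv xi 1" and "y = deriv (deriv xi) 1 / deriv xi 1"
  have ay: "a > 0" "y > 0" "deriv (deriv xi) 1 = a * y" using assms by (auto simp: a_def y_def)
  have "ABA xi = ln y - (a * y - a) * (a * y - a + a^2) / (a * y * a^2)"
    unfolding ABA_def Let_def a_def[symmetric] ay(3) using ay by simp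
  also have "(a * y - a) * (a * y - a + a^2) / (a * y * a^2) = ((y - 1) + (y - 1)^2 / a) / y"
    using ay by (simp add: field_simps power2_eq_square)
  \<comment> \<open>Multiplying by \<open>y > 0\<close> turns \<open>ABA\<close> into
    \<open>ratio_fun a y\<close>, whose sign is known from the position of \<open>y\<close> relative
    to the root.\<close>
  finally have "ABA xi * y = y * ln y - ((y - 1) + (y - 1)^2 / a)"
    using ay by (simp add: field_simps)
  then have "ratio_fun a y = ABA xi * y" unfolding ratio_fun_def by simp
  then have "ABA xi \<ge> 0 \<longleftrightarrow> ratio_fun a y \<ge> 0" using ay by (simp add: zero_le_mult_iff)
  then show ?thesis unfolding a_def y_def .
qed

text \<open>Differentiating the double integral twice gives \<open>1 / \<phi>\<^sup>2\<close>, and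
  \<phi>(0) = \<open>c + m\<close>.\<close>

lemma replicon_eq:
  assumes "mc_sol xi = (m, c)" "m > 0" "c > 0"
  shows "replicon xi = 1 / (c + m)^2 - deriv (deriv xi) 0"
proof -
  define w where "w = (\<lambda>t. 1 / (phi_sol xi t)^2)"
  define g where "g = (\<lambda>s. integral {0..s} w)"
  have phi: "phi_sol xi = (\<lambda>t. m * (1 - t) + c)" unfolding phi_sol_def assms(1) by simp
  have "m * (1 - t) + c > 0" if "t \<in> {0..1}" for t
    using that assms by (auto intro: add_nonneg_pos)
  then have cw: "continuous_on {0..1} w"
    unfolding w_def phi by (intro continuous_intros) force
  have g': "(g has_vector_derivative w t) (at t within {0..1})" if "t \<in> {0..1}" for t
    unfolding g_def using cw that by (rule integral_has_vector_derivative)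
  have cg: "continuous_on {0..1} g"
    using g' by (intro continuous_on_vector_derivative) auto
  have eta: "(eta_conj xi has_vector_derivative g t) (at t within {0..1})" if t: "t \<in> {0..1}" for t
  proof -
    have "((\<lambda>u. integral {0..u} g) has_vector_derivative g t) (at t within {0..1})"
      using cg t by (rule integral_has_vector_derivative)
    \<comment> \<open>The integral from \<open>u\<close> to 1 is traded for one from 0 to
      \<open>u\<close>, so that \<open>u\<close> is an upper limit.\<close>
    then have "((\<lambda>u. xi 1 - integral {0..1} g + integral {0..u} g) has_vector_derivative 0 + g t) (at t within {0..1})"
      by (intro has_vector_derivative_add has_vector_derivative_const)
    moreover have "xi 1 - integral {0..1} g + integral {0..u} g = eta_conj xi u" if u: "u \<in> {0..1}" for u
    proof -
      have "integral {0..u} g + integral {u..1} g = integral {0..1} g"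
        using u integrable_continuous_real[OF cg] by (intro Henstock_Kurzweil_Integration.integral_combine) auto
      then show ?thesis unfolding eta_conj_def g_def w_def by simp
    qed
    ultimately show ?thesis
      by (intro has_vector_derivative_transform[OF t, where g = "eta_conj xi"]) auto
  qed
  have vd: "vector_derivative (eta_conj xi) (at t within {0..1}) = g t" if "t \<in> {0..1}" for t
    using vector_derivative_within_cbox[of 0 1 t, OF _ _ eta[OF that, folded cbox_interval]] that
    by (simp add: cbox_interval)
  have "((\<lambda>t. vector_derivative (eta_conj xi) (at t within {0..1})) has_vector_derivative w 0)
      (at 0 within {0..1})"
    by (rule has_vector_derivative_transform[OF _ _ g']) (use vd in auto)
  then have "vector_derivative (\<lambda>t. vector_derivative (eta_conj xi) (at t within {0..1})) (at 0 within {0..1}) = w 0"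
    using vector_derivative_within_cbox[of 0 1 0] by (simp add: cbox_interval)
  then show ?thesis unfolding replicon_def by (simp add: w_def phi add.commute)
qed

text \<open>The sign of \<open>ABA\<close> compares \<open>nu2 / nu\<close> with the root
  \<open>x0 = (c + m) / c\<close>. Since \<open>nu * x0 = 1 / c^2\<close>, this compares
  \<open>nu2\<close> with \<open>1 / \<phi>\<^sup>2\<close> at 1.\<close>

lemma xi_mix_gap_conditions:
  fixes n :: nat and mu m c :: real
  defines "xi \<equiv> xi_mix mu (n + 3)"
  assumes mu: "0 \<le> mu" "mu < 1" and mc: "m > 0" "c > 0" and st: "stationary (deriv xi 1) m c"
  shows "replicon xi \<ge> 0 \<longleftrightarrow> deriv (deriv xi) 0 - 1 / (c + m)^2 \<le> 0"
    and "pure_like xi \<or> critical xi \<longleftrightarrow> deriv (deriv xi) 1 - 1 / c^2 \<le> 0"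
proof -
  define nu where "nu = deriv xi 1"
  define nu2 where "nu2 = deriv (deriv xi) 1"
  have nu: "nu = 2 + (1 - mu) * (real n + 1)"
    unfolding nu_def xi_def deriv_xi_mix by (simp add: algebra_simps)
  have nu2: "nu2 = nu + (1 - mu) * (real n + 3) * (real n + 1)"
    unfolding nu_def nu2_def xi_def deriv_xi_mix(2) unfolding deriv_xi_mix(1) by (simp add: algebra_simps)
  have gt: "nu > 2" "nu2 > nu" using mu unfolding nu nu2 by auto
  have "mc_sol xi = (m, c)"
    using gt mc st by (intro mc_sol_eq) (auto simp: xi_def xi_mix_def nu_def)
  from replicon_eq[OF this mc]
  show "replicon xi \<ge> 0 \<longleftrightarrow> deriv (deriv xi) 0 - 1 / (c + m)^2 \<le> 0" by auto
  have sol: "1 / nu = c * (c + m)" "ratio_fun nu ((c + m) / c) = 0"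
    using stationary_iff_ratio[of m c nu] st mc gt unfolding nu_def by auto
  obtain x0 where x0: "\<And>x. x > 1 \<Longrightarrow> ratio_fun nu x = 0 \<Longrightarrow> x = x0"
      "\<And>x. x > 1 \<Longrightarrow> 0 \<le> ratio_fun nu x \<longleftrightarrow> x \<le> x0"
    using ratio_fun_root[OF gt(1)] by metis
  have x: "(c + m) / c = x0" using sol mc by (intro x0(1)) auto
  have "nu * x0 = 1 / c^2"
  proof -
    have "nu = 1 / (c * (c + m))" using sol(1) gt by (metis divide_divide_eq_right mult_1 div_by_1)
    then show ?thesis unfolding x[symmetric] using mc by (simp add: power2_eq_square)
  qed
  moreover have "pure_like xi \<or> critical xi \<longleftrightarrow> ABA xi \<ge> 0"
    unfolding pure_like_def critical_def by auto
  moreover have "ABA xi \<ge> 0 \<longleftrightarrow> nu2 / nu \<le> x0"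
    using ABA_nonneg_iff[of xi] x0(2)[of "nu2 / nu"] gt unfolding nu_def[symmetric] nu2_def[symmetric]
    by simp
  moreover have "nu2 / nu \<le> x0 \<longleftrightarrow> nu2 \<le> nu * x0"
    using gt by (simp add: field_simps)
  ultimately show "pure_like xi \<or> critical xi \<longleftrightarrow> deriv (deriv xi) 1 - 1 / c^2 \<le> 0"
    unfolding nu2_def by simp
qed

section \<open>Necessity and sufficiency of the gap conditions\<close>

lemma gap_integrals:
  fixes n :: nat and mu m c :: real
  defines "xi \<equiv> xi_mix mu (n + 3)"
  assumes mc: "m > 0" "c > 0"
  shows "((\<lambda>t. deriv (deriv xi) t - 1 / (c + m * (1 - t))^2) has_integral
      deriv xi 1 - 1 / (c * (c + m))) {0..1}"
    and "((\<lambda>t. (deriv (deriv xi) t - 1 / (c + m * (1 - t))^2) * (1 - t)) has_integral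
      1 - (1 / m) * ((1 / m) * ln ((c + m) / c) - 1 / (c + m))) {0..1}"
  using has_integral_diff[OF xi_mix_integrals(1) affine_weight_integrals(1)[OF mc]]
    has_integral_diff[OF xi_mix_integrals(2) affine_weight_integrals(2)[OF mc]]
  unfolding xi_def left_diff_distrib by simp_all

lemma continuous_gap:
  fixes n :: nat and mu m c :: real
  assumes "m > 0" "c > 0"
  shows "continuous_on {0..1} (deriv (deriv (xi_mix mu (n + 3))))"
    and "continuous_on {0..1} (\<lambda>t. deriv (deriv (xi_mix mu (n + 3))) t - 1 / (c + m * (1 - t))^2)"
proof -
  have "c + m * (1 - t) > 0" if "t \<in> {0..1}" for t
    using that assms by (auto intro: add_pos_nonneg)
  then have "\<forall>t\<in>{0..1}. (c + m * (1 - t))^2 \<noteq> 0" by force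
  then show "continuous_on {0..1} (\<lambda>t. deriv (deriv (xi_mix mu (n + 3))) t - 1 / (c + m * (1 - t))^2)"
    unfolding deriv_xi_mix(2) by (intro continuous_intros) auto
qed (unfold deriv_xi_mix(2), intro continuous_intros)

lemma minimizer_imp_stationary:
  fixes n :: nat and mu m c :: real
  defines "xi \<equiv> xi_mix mu (n + 3)"
  assumes mc: "m > 0" "c > 0" and nu: "deriv xi 1 > 0"
    and min: "is_minimizer xi (\<lambda>t. c + m * (1 - t))"
  shows "stationary (deriv xi 1) m c"
    and "deriv (deriv xi) 0 - 1 / (c + m)^2 \<le> 0"
    and "deriv (deriv xi) 1 - 1 / c^2 \<le> 0"
proof -
  define h where "h = (\<lambda>t. deriv (deriv xi) t - 1 / (c + m * (1 - t))^2)"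
  note cont = continuous_gap[OF mc, of mu n, folded xi_def]
  have ch: "continuous_on {0..1} h" using cont(2) by (simp add: h_def)
  have var: "0 \<le> integral {0..1} (\<lambda>t. h t * f t)"
    if "concave_on {0..1} f" "\<And>x y. \<bar>f x - f y\<bar> \<le> \<bar>x - y\<bar>" "\<And>t. t \<in> {0..1} \<Longrightarrow> \<bar>f t\<bar> \<le> 1" for f
    unfolding h_def using affine_minimizer_variation[OF min mc cont(1) that] by blast
  note I = gap_integrals[OF mc, of mu n, folded xi_def]
  \<comment> \<open>For affine \<open>f\<close> both \<open>f\<close> and \<open>- f\<close> are
    concave, so the variation is bounded below by 0 in both directions.\<close>
  have z: "J = 0" if J: "((\<lambda>t. h t * f t) has_integral J) {0..1}"
    and f: "\<And>t. f t = a + b * t" "\<bar>b\<bar> \<le> 1" "\<And>t. t \<in> {0..1} \<Longrightarrow> \<bar>f t\<bar> \<le> 1" for J f a b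
  proof -
    have f': "f = (\<lambda>t. a + b * t)" "(\<lambda>t. - f t) = (\<lambda>t. - a + (- b) * t)" using f(1) by auto
    have lip: "\<bar>f x - f y\<bar> \<le> \<bar>x - y\<bar>" for x y
    proof -
      have "\<bar>f x - f y\<bar> = \<bar>b\<bar> * \<bar>x - y\<bar>" unfolding f(1) by (simp add: abs_mult[symmetric] algebra_simps)
      also have "\<dots> \<le> 1 * \<bar>x - y\<bar>" using f(2) by (intro mult_right_mono) auto
      finally show ?thesis by simp
    qed
    have "0 \<le> integral {0..1} (\<lambda>t. h t * f t)"
      by (rule var) (use lip f(3) concave_on_affine[of a b] f'(1) in auto)
    moreover have "0 \<le> integral {0..1} (\<lambda>t. h t * (- f t))"
      by (rule var) (use lip f(3) concave_on_affine[of "- a" "- b"] f'(2) in \<open>auto simp: abs_minus_commute\<close>)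
    ultimately show ?thesis using integral_unique[OF J] by simp
  qed
  have "deriv xi 1 - 1 / (c * (c + m)) = 0"
    by (rule z[of "\<lambda>t. 1" _ 1 0]) (use I(1) in \<open>auto simp: h_def\<close>)
  moreover have "1 - (1 / m) * ((1 / m) * ln ((c + m) / c) - 1 / (c + m)) = 0"
    by (rule z[of "\<lambda>t. 1 - t" _ 1 "- 1"]) (use I(2) in \<open>auto simp: h_def\<close>)
  ultimately show "stationary (deriv xi 1) m c"
    unfolding stationary_def using nu mc by simp
  \<comment> \<open>Perturbing by the concave function \<open>- w\<close> would lower the functional
    to first order.\<close>
  have test: False if w: "continuous_on {0..1} w" "\<And>t. t \<in> {0..1} \<Longrightarrow> 0 \<le> h t * w t"
    "t0 \<in> {0..1}" "0 < h t0 * w t0" "concave_on {0..1} (\<lambda>t. - w t)"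
    "\<And>x y. \<bar>w x - w y\<bar> \<le> \<bar>x - y\<bar>" "\<And>t. t \<in> {0..1} \<Longrightarrow> \<bar>w t\<bar> \<le> 1" for w t0
  proof -
    have "0 < integral {0..1} (\<lambda>t. h t * w t)"
      using w by (intro integral_pos_if_continuous_nonneg[of _ t0] continuous_on_mult ch) auto
    moreover have "0 \<le> integral {0..1} (\<lambda>t. h t * (- w t))"
      by (rule var) (use w in \<open>auto simp: abs_minus_commute\<close>)
    ultimately show False by simp
  qed
  have near: "\<exists>d>0. \<forall>t\<in>{0..1}. \<bar>t - t0\<bar> < d \<longrightarrow> h t > 0" if t0: "t0 \<in> {0..1}" "h t0 > 0" for t0
  proof -
    obtain d where "d > 0" "\<forall>t\<in>{0..1}. dist t t0 < d \<longrightarrow> dist (h t) (h t0) < h t0"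
      using ch t0 unfolding continuous_on_iff by blast
    then show ?thesis by (intro exI[of _ d]) (auto simp: dist_real_def abs_if split: if_splits)
  qed
  have cvx: "concave_on {0..1} (\<lambda>t. - max 0 (a + b * t))" for a b :: real
    unfolding concave_on_iff
  proof (intro conjI ballI allI impI)
    fix x y u v :: real assume uv: "0 \<le> u" "0 \<le> v" "u + v = 1"
    have v: "v = 1 - u" using uv(3) by simp
    have "a + b * (u * x + v * y) = u * (a + b * x) + v * (a + b * y)"
      unfolding v by (simp add: algebra_simps)
    also have "\<dots> \<le> u * max 0 (a + b * x) + v * max 0 (a + b * y)"
      using uv by (intro add_mono mult_left_mono) auto
    finally have "a + b * (u * x + v * y) \<le> u * max 0 (a + b * x) + v * max 0 (a + b * y)" .
    moreover have "0 \<le> u * max 0 (a + b * x) + v * max 0 (a + b * y)" using uv by simp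
    ultimately have "max 0 (a + b * (u * x + v * y)) \<le> u * max 0 (a + b * x) + v * max 0 (a + b * y)"
      by (intro max.boundedI)
    then show "u * (- max 0 (a + b * x)) + v * (- max 0 (a + b * y))
        \<le> - max 0 (a + b * (u *\<^sub>R x + v *\<^sub>R y))"
      unfolding real_scaleR_def mult_minus_right by linarith
  qed simp
  show "deriv (deriv xi) 0 - 1 / (c + m)^2 \<le> 0"
  proof (rule ccontr)
    assume "\<not> ?thesis"
    then have h0: "h 0 > 0" by (simp add: h_def)
    then obtain d where d: "d > 0" "\<forall>t\<in>{0..1}. \<bar>t - 0\<bar> < d \<longrightarrow> h t > 0" using near[of 0] by auto
    \<comment> \<open>The hinge of height \<open>s\<close> lives where \<open>h > 0\<close>;
      \<open>s \<le> 1\<close> and slope \<open>- 1\<close> meet the bounds on test functions. The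
      end point 1 is treated by reflection.\<close>
    define s where "s = min d 1"
    show False
    proof (rule test[of "\<lambda>t. max 0 (s + (- 1) * t)" 0])
      fix t :: real assume "t \<in> {0..1}"
      then show "0 \<le> h t * max 0 (s + (- 1) * t)"
        using d by (cases "t < s") (auto simp: s_def less_imp_le)
    qed (use d h0 cvx[of s "- 1"] in \<open>auto simp: s_def intro!: continuous_intros\<close>)
  qed
  show "deriv (deriv xi) 1 - 1 / c^2 \<le> 0"
  proof (rule ccontr)
    assume "\<not> ?thesis"
    then have h0: "h 1 > 0" by (simp add: h_def)
    then obtain d where d: "d > 0" "\<forall>t\<in>{0..1}. \<bar>t - 1\<bar> < d \<longrightarrow> h t > 0" using near[of 1] by auto
    define s where "s = min d 1"
    show False
    proof (rule test[of "\<lambda>t. max 0 ((s - 1) + 1 * t)" 1])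
      fix t :: real assume "t \<in> {0..1}"
      then show "0 \<le> h t * max 0 ((s - 1) + 1 * t)"
        using d by (cases "1 - t < s") (auto simp: s_def less_imp_le)
    qed (use d h0 cvx[of "s - 1" 1] in \<open>auto simp: s_def intro!: continuous_intros\<close>)
  qed
qed

text \<open>The system makes \<open>h\<close> orthogonal to affine functions, \<phi> included, so
  the first variation towards \<open>psi\<close> is the integral of \<open>h * psi\<close>,
  non-negative by concavity; convexity of the functional does the rest.\<close>

lemma stationary_imp_minimizer:
  fixes n :: nat and mu m c :: real
  defines "xi \<equiv> xi_mix mu (n + 3)"
  assumes mu: "0 \<le> mu" "mu < 1" and mc: "m > 0" "c > 0" and st: "stationary (deriv xi 1) m c"
    and h0: "deriv (deriv xi) 0 - 1 / (c + m)^2 \<le> 0"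
    and h1: "deriv (deriv xi) 1 - 1 / c^2 \<le> 0"
  shows "is_minimizer xi (\<lambda>t. c + m * (1 - t))"
proof -
  define phi where "phi = (\<lambda>t. c + m * (1 - t))"
  define h where "h = (\<lambda>t. deriv (deriv xi) t - 1 / (c + m * (1 - t))^2)"
  note cont = continuous_gap[OF mc, of mu n, folded xi_def]
  have ch: "continuous_on {0..1} h" using cont(2) by (simp add: h_def)
  have cphi: "continuous_on {0..1} phi" unfolding phi_def by (intro continuous_intros)
  have nu: "deriv xi 1 \<noteq> 0" using st mc unfolding stationary_def by auto
  then have eqs: "deriv xi 1 = 1 / (c * (c + m))"
      "1 = (1 / m) * ((1 / m) * ln ((c + m) / c) - 1 / (c + m))"
    using st unfolding stationary_def by (metis divide_divide_eq_right div_by_1 mult_1)+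
  note I = gap_integrals[OF mc, of mu n, folded xi_def]
  have o1: "(h has_integral 0) {0..1}" using I(1) eqs(1) by (simp add: h_def)
  have o2: "((\<lambda>t. h t * (1 - t)) has_integral 0) {0..1}" using I(2) unfolding h_def eqs(2)[symmetric] by simp
  have nd: "no_dip h"
    using no_dip_gap[OF mc mu(1), of "(1 - mu) * (real n + 3) * (real n + 2)" n] mu h0
    unfolding h_def xi_def deriv_xi_mix(2) by simp
  have ip: "((\<lambda>t. h t * phi t) has_integral 0) {0..1}"
    using has_integral_add[OF has_integral_mult_right[OF o1, of c] has_integral_mult_right[OF o2, of m]]
    unfolding phi_def by (simp add: algebra_simps)
  have "phi \<in> classC"
    using affine_perturbation_in_classC[OF mc, of 0 "\<lambda>t. 0"] mc
    by (simp add: phi_def concave_on_const)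
  moreover have "P0 xi phi \<le> P0 xi psi" if psi: "psi \<in> classC" for psi
  proof (rule P0_le_if_first_variation_nonneg[OF cont(1) cphi])
    show cpsi: "continuous_on {0..1} psi" using psi by (simp add: classC_def)
    have "0 \<le> integral {0..1} (\<lambda>t. h t * psi t)"
      using psi h0 h1
      by (intro integral_mult_concave_nonneg[OF ch nd _ _ o1 o2]) (auto simp: classC_def h_def)
    moreover have "((\<lambda>t. h t * psi t - h t * phi t) has_integral integral {0..1} (\<lambda>t. h t * psi t) - 0) {0..1}"
      by (intro has_integral_diff ip integrable_integral integrable_continuous_real continuous_on_mult ch cpsi)
    ultimately show "0 \<le> integral {0..1} (\<lambda>t. (deriv (deriv xi) t - 1 / (phi t)^2) * (psi t - phi t))"
      unfolding h_def phi_def by (simp add: integral_unique right_diff_distrib)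
  qed (use mc in \<open>auto simp: phi_def intro: add_pos_nonneg\<close>)
  ultimately show ?thesis unfolding is_minimizer_def phi_def by blast
qed

theorem theorem1p25:
  fixes p :: nat and mu :: real
  assumes "p \<ge> 3" and "0 \<le> mu" and "mu < 1"
  shows "(\<exists>m c. m > 0 \<and> c > 0 \<and> is_minimizer (xi_mix mu p) (\<lambda>t. c + m * (1 - t)))
     \<longleftrightarrow> (replicon (xi_mix mu p) \<ge> 0 \<and>
          (pure_like (xi_mix mu p) \<or> critical (xi_mix mu p)))"
proof -
  \<comment> \<open>The shift keeps the exponents of all derivatives free of truncated
    subtraction.\<close>
  define n where "n = p - 3"
  have p: "p = n + 3" using assms(1) by (simp add: n_def)
  define xi where "xi = xi_mix mu (n + 3)"
  have "deriv xi 1 = 2 + (1 - mu) * (real n + 1)"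
    unfolding xi_def deriv_xi_mix by (simp add: algebra_simps)
  then have nu: "deriv xi 1 > 2" using assms(3) by simp
  note conditions = xi_mix_gap_conditions[OF assms(2,3), where n = n, folded xi_def]
  show ?thesis unfolding p xi_def[symmetric]
  proof
    assume "\<exists>m c. m > 0 \<and> c > 0 \<and> is_minimizer xi (\<lambda>t. c + m * (1 - t))"
    then obtain m c where mc: "m > 0" "c > 0" and min: "is_minimizer xi (\<lambda>t. c + m * (1 - t))"
      by blast
    have "deriv xi 1 > 0" using nu by simp
    from minimizer_imp_stationary[OF mc this[unfolded xi_def] min[unfolded xi_def], folded xi_def]
    show "replicon xi \<ge> 0 \<and> (pure_like xi \<or> critical xi)"
      using conditions[OF mc] by blast
  next
    assume R: "replicon xi \<ge> 0 \<and> (pure_like xi \<or> critical xi)"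
    \<comment> \<open>The pair exists for every such \<xi>; the two conditions only decide whether
      its affine function is the minimizer.\<close>
    obtain m c where mc: "m > 0" "c > 0" "stationary (deriv xi 1) m c"
      using stationary_exists[OF nu] .
    have "is_minimizer xi (\<lambda>t. c + m * (1 - t))"
      using stationary_imp_minimizer[OF assms(2,3) mc[unfolded xi_def], folded xi_def]
        conditions[OF mc] R by blast
    then show "\<exists>m c. m > 0 \<and> c > 0 \<and> is_minimizer xi (\<lambda>t. c + m * (1 - t))"
      using mc by blast
  qed
qed

end
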